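(* For $\operatorname{Re} z>0$ the function $1-G$ has the representation $$ 1-G(z)=\int_0^\infty e^{-zs}\varphi(s)\,ds, $$ where $$ \varphi(s)=\int_0^\infty e^{-st}\rho(t)\,dt>0\quad\text{for all } s\ge 0. $$
   Context: Let $\mathcal A=\mathbb C\setminus(-\infty,0]$ and let $\operatorname{Log} z=\ln|z|+i\operatorname{Arg} z$ be the principal logarithm on $\mathcal A$, with $-\pi<\operatorname{Arg} z<\pi$. The function $G$ is defined by $$ G(z)=\left(1-\frac{\operatorname{Log} z}{\operatorname{Log}(1+z)}\right)z\operatorname{Log} z,\quad z\in\mathcal A. $$ The function $\rho$ on $(0,\infty)$ is defined by $$ \rho(t)=\begin{cases} -\dfrac{t\ln\left((1-t)/t^2\right)}{\ln(1-t)}, & 0<t<1,\\[2ex] -\dfrac{t\left(\ln\left((t-1)/t\right)\right)^2}{(\ln(t-1))^2+\pi^2}, & 1<t<\infty, \end{cases} $$ extended continuously by $\rho(1)=-1$; it is integrable over $(0,\infty)$. *)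

theory Defs
  imports "HOL-Analysis.Analysis"
begin

(* Ln is total, with -pi < Im (Ln z) <= pi; it is the principal logarithm on the slit plane
   - \<real>\<^sub>\<le>\<^sub>0, and only values of G there are meaningful. *)
definition G :: "complex \<Rightarrow> complex" where
  "G z = (1 - Ln z / Ln (1 + z)) * z * Ln z"

(* The value -1 at t = 1 is the continuous extension; 0 for t <= 0 is a dummy value. *)
definition \<rho> :: "real \<Rightarrow> real" where
  "\<rho> t =
     (if 0 < t \<and> t < 1 then - (t * ln ((1 - t) / t\<^sup>2)) / ln (1 - t)
      else if 1 < t then - (t * (ln ((t - 1) / t))\<^sup>2) / ((ln (t - 1))\<^sup>2 + pi\<^sup>2)
      else if t = 1 then - 1
      else 0)"

definition \<phi> :: "real \<Rightarrow> real" where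
  "\<phi> s = (LINT t:{0<..}|lborel. exp (- s * t) * \<rho> t)"

end

(* The function 1 - G is holomorphic off the half-line (-infinity, 0], is O(|z|^(-1/2)) on the upper
   half-plane and has boundary values b from above. Cauchy's formula on rectangles gives
   int b(x)/(x - w) dx = 2 pi i (1 - G(w)) and int b(x)/(x - conj w) dx = 0 for Im w > 0. Conjugating
   the second formula and subtracting leaves Im b, which vanishes on (0, infinity) and equals
   -pi rho(t) at x = -t; hence 1 - G(w) = int rho(t)/(t + w) dt, and Fubini turns this Stieltjes
   transform into an iterated Laplace transform.

   For positivity, x (1 - G(x)) tends to 1/2 as x tends to infinity, so int rho = 1/2. As rho changes
   sign only once, from + to - at t0 say, phi(s) >= exp(-s t0) int rho > 0. *)

theory Submission
  imports Defs "HOL-Complex_Analysis.Complex_Analysis" "HOL-Real_Asymp.Real_Asymp"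
begin

section \<open>Cauchy's formula for the half-plane\<close>

text \<open>The exponent 1/2 reconciles two ends. At 0 the function \<open>1 - G z\<close> grows
  like \<open>(Ln z)^2\<close>, because \<open>Ln (1 + z)\<close> is close to \<open>z\<close>
  there; at infinity it decays like \<open>1 / z\<close>. Any power strictly between 0 and 1 covers
  both, is integrable near 0, and makes the far sides of the rectangles vanish in the limit. The
  point -1 is harmless: \<open>Ln (1 + z)\<close> is large near it and occurs only as a divisor.
  Since 0 and -1 lie on the boundary, the formula is not applied on the real axis itself: the
  function is shifted upwards, where it is holomorphic past the axis, and the shift is removed by
  dominated convergence, so that boundary values almost everywhere suffice. The second obstacle is
  the tail of \<open>\<rho>\<close>, which is like \<open>-1 / (t * (ln t)^2)\<close> and thus only
  just integrable. Cauchy's formula yields the integrability of \<open>\<rho> t / (1 + t)\<close>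
  alone; that of \<open>\<rho>\<close> is extracted from the asymptotics of \<open>1 - G\<close>
  along the positive axis.\<close>

text \<open>The majorant of the boundary integrals: \<open>1 / sqrt |x|\<close> comes from the
  growth bound, \<open>1 / (1 + |x|)\<close> from the Cauchy kernel. On the positive half-line
  \<open>2 * arctan (sqrt x)\<close> is an antiderivative with finite limits; the other half is its
  mirror image.\<close>

lemma integrable_inverse_sqrt_times_inverse:
  "integrable lborel (\<lambda>x::real. 1 / (sqrt \<bar>x\<bar> * (1 + \<bar>x\<bar>)))"
proof -
  let ?h = "\<lambda>x::real. 1 / (sqrt \<bar>x\<bar> * (1 + \<bar>x\<bar>))"
  have "set_integrable lborel (einterval 0 \<infinity>) ?h"
  proof (rule interval_integral_FTC_nonneg[where F = "\<lambda>x. 2 * arctan (sqrt x)"])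
    fix x :: real assume "0 < ereal x"
    then have x: "x > 0" by simp
    have "((\<lambda>x. 2 * arctan (sqrt x)) has_real_derivative
        2 * (inverse (1 + (sqrt x)\<^sup>2) * (inverse (sqrt x) / 2))) (at x)"
      using x by (auto intro!: derivative_eq_intros)
    moreover have "2 * (inverse a * (inverse b / 2)) = 1 / (b * a)" for a b :: real
      by (simp add: inverse_eq_divide)
    note this[of "1 + (sqrt x)\<^sup>2" "sqrt x"]
    ultimately show "((\<lambda>x. 2 * arctan (sqrt x)) has_real_derivative ?h x) (at x)"
      using x by (metis abs_of_pos real_sqrt_pow2 less_imp_le)
    show "isCont ?h x"
      using x by (intro continuous_intros) auto
  next
    show "(((\<lambda>x. 2 * arctan (sqrt x)) \<circ> real_of_ereal) \<longlongrightarrow> 0) (at_right 0)"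
      unfolding zero_ereal_def ereal_tendsto_simps by real_asymp
    show "(((\<lambda>x. 2 * arctan (sqrt x)) \<circ> real_of_ereal) \<longlongrightarrow> pi) (at_left \<infinity>)"
      unfolding ereal_tendsto_simps by real_asymp
  qed auto
  moreover have "einterval 0 \<infinity> = {0::real<..}"
    by (auto simp: einterval_def)
  ultimately have int: "integrable lborel (\<lambda>x. indicator {0<..} x *\<^sub>R ?h x)"
    by (simp add: set_integrable_def)
  then have "integrable lborel (\<lambda>x. indicator {0<..} (0 + (-1) * x) *\<^sub>R ?h (0 + (-1) * x))"
    by (rule lborel_integrable_real_affine) simp
  \<comment> \<open>The two halves add up to the function even at 0, where division by zero makes it
    0.\<close>
  from Bochner_Integration.integrable_add[OF int this]
  show ?thesis
    by (rule Bochner_Integration.integrable_cong[THEN iffD1, rotated -1])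
       (auto simp: indicator_def)
qed

text \<open>The rectangle has base \<open>[-R, R]\<close> and height \<open>R\<close>. Its other
  three sides have total length \<open>4 * R\<close>, and on them \<open>|z - w| >= R / 2\<close>,
  so the integrand is at most \<open>2 * M / R\<close> and they contribute at most
  \<open>8 * M\<close>. Holomorphy slightly below the axis places the base inside the
  domain.\<close>

lemma cauchy_rectangle_estimate:
  fixes F :: "complex \<Rightarrow> complex"
  assumes hol: "F holomorphic_on {z. Im z > - e}" and "e > 0"
    and w: "Im w \<noteq> 0" "2 * norm w < R"
    and bd: "\<And>z. Im z \<ge> 0 \<Longrightarrow> norm z \<ge> R \<Longrightarrow> norm (F z) \<le> M"
  shows "norm (integral {-R..R} (\<lambda>x. F (of_real x) / (of_real x - w)) -
              (if Im w > 0 then 2 * pi * \<i> * F w else 0)) \<le> 8 * M"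
proof -
  let ?J = "if Im w > 0 then 2 * pi * \<i> * F w else 0"
  let ?g = "\<lambda>z. F z / (z - w)"
  define a3 where "a3 = Complex R R"
  define a1 a2 a4 where "a1 = complex_of_real (-R)" and "a2 = complex_of_real R" and "a4 = Complex (-R) R"
  have R: "R > 0"
    using w(2) norm_ge_zero[of w] by linarith
  have "norm (F a2) \<le> M"
    by (rule bd) (use R in \<open>auto simp: a2_def\<close>)
  then have M: "M \<ge> 0"
    using norm_ge_zero order_trans by blast
  have rect: "rectpath a1 a3 = linepath a1 a2 +++ linepath a2 a3 +++ linepath a3 a4 +++ linepath a4 a1"
    by (simp add: rectpath_def Let_def a1_def a2_def a3_def a4_def complex_of_real_def)
  have absw: "\<bar>Re w\<bar> < R / 2" "\<bar>Im w\<bar> < R / 2"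
    using abs_Re_le_cmod[of w] abs_Im_le_cmod[of w] w(2) by linarith+
  have pimg: "path_image (rectpath a1 a3) \<subseteq> {z. Im z \<ge> 0} - {w}"
    using R absw w(1) by (subst path_image_rectpath) (auto simp: a1_def a3_def)
  have loop: "valid_path (rectpath a1 a3)" "pathfinish (rectpath a1 a3) = pathstart (rectpath a1 a3)"
    by auto
  have total: "(?g has_contour_integral ?J) (rectpath a1 a3)"
  proof (cases "Im w > 0")
    case True
    have "(?g has_contour_integral (2 * pi * \<i> * winding_number (rectpath a1 a3) w * F w)) (rectpath a1 a3)"
    proof (rule Cauchy_integral_formula_convex_simple[OF _ hol])
      show "convex {z. Im z > - e}" by (rule convex_halfspace_Im_gt)
      show "w \<in> interior {z. Im z > - e}"
        using True \<open>e > 0\<close> by (subst interior_open) (auto simp: open_halfspace_Im_gt)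
      show "path_image (rectpath a1 a3) \<subseteq> {z. Im z > - e} - {w}"
        using pimg \<open>e > 0\<close> by force
    qed (use loop in auto)
    moreover have "winding_number (rectpath a1 a3) w = 1"
      by (rule winding_number_rectpath)
         (use True absw R in \<open>auto simp: in_box_complex_iff a1_def a3_def abs_if split: if_splits\<close>)
    ultimately show ?thesis using True by simp
  next
    case False
    then have "Im w < 0" using w by simp
    have "(?g has_contour_integral 0) (rectpath a1 a3)"
    proof (rule Cauchy_theorem_convex_simple)
      \<comment> \<open>This half-plane contains the rectangle but not the pole \<open>w\<close>,
        which lies below the axis.\<close>
      show "?g holomorphic_on {z. Im z > max (-e) (Im w)}"
        by (intro holomorphic_intros holomorphic_on_subset[OF hol]) auto
      show "path_image (rectpath a1 a3) \<subseteq> {z. Im z > max (-e) (Im w)}"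
        using pimg \<open>e > 0\<close> \<open>Im w < 0\<close> by force
      show "convex {z. Im z > max (-e) (Im w)}" by (rule convex_halfspace_Im_gt)
    qed (use loop in auto)
    then show ?thesis using False by simp
  qed
  have cont: "continuous_on ({z. Im z \<ge> 0} - {w}) ?g"
    by (intro continuous_intros continuous_on_subset[OF holomorphic_on_imp_continuous_on[OF hol]])
       (use \<open>e > 0\<close> in auto)
  have segs: "closed_segment a1 a2 \<subseteq> path_image (rectpath a1 a3)"
    "closed_segment a2 a3 \<subseteq> path_image (rectpath a1 a3)"
    "closed_segment a3 a4 \<subseteq> path_image (rectpath a1 a3)"
    "closed_segment a4 a1 \<subseteq> path_image (rectpath a1 a3)"
    by (auto simp: rect path_image_join)
  note ci = segs[THEN order_trans[OF _ pimg], THEN continuous_on_subset[OF cont],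
      THEN contour_integrable_continuous_linepath]
  have "?J = contour_integral (rectpath a1 a3) ?g"
    by (rule contour_integral_unique[OF total, symmetric])
  also have "\<dots> = contour_integral (linepath a1 a2) ?g + (contour_integral (linepath a2 a3) ?g
     + (contour_integral (linepath a3 a4) ?g + contour_integral (linepath a4 a1) ?g))"
    unfolding rect using ci by (simp add: contour_integrable_joinI)
  also have "contour_integral (linepath a1 a2) ?g
      = integral {Re a1..Re a2} (\<lambda>x. F (of_real x) / (of_real x - w))"
    by (rule contour_integral_linepath_Reals_eq) (use R in \<open>auto simp: a1_def a2_def\<close>)
  finally have eq: "integral {-R..R} (\<lambda>x. F (of_real x) / (of_real x - w)) - ?J =
     - (contour_integral (linepath a2 a3) ?g
     + (contour_integral (linepath a3 a4) ?g + contour_integral (linepath a4 a1) ?g))"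
    by (simp add: a1_def a2_def)
  have far: "norm (?g z) \<le> M * (2 / R)" if "Im z \<ge> 0" "norm z \<ge> R" for z
  proof -
    have "norm (z - w) \<ge> R / 2"
      using norm_triangle_ineq2[of z w] that w(2) by linarith
    then have "1 / norm (z - w) \<le> 2 / R"
      using R frac_le[of 1 1 "R / 2" "norm (z - w)"] by simp
    then show ?thesis
      using mult_mono[OF bd[OF that], of "1 / norm (z - w)" "2 / R"] M by (simp add: norm_divide)
  qed
  have sides: "Im z \<ge> 0 \<and> norm z \<ge> R"
    if "z \<in> closed_segment a2 a3 \<union> closed_segment a3 a4 \<union> closed_segment a4 a1" for z
  proof -
    have "Im z \<ge> 0" "\<bar>Re z\<bar> = R \<or> Im z = R"
      using that R
      by (auto simp: closed_segment_same_Re closed_segment_same_Im a1_def a2_def a3_def a4_def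
          closed_segment_eq_real_ivl)
    then show ?thesis
      using abs_Re_le_cmod[of z] abs_Im_le_cmod[of z] by auto
  qed
  have B: "0 \<le> M * (2 / R)" using M R by simp
  have "norm (contour_integral (linepath a2 a3) ?g) \<le> M * (2 / R) * norm (a3 - a2)"
    by (rule contour_integral_bound_linepath[OF ci(2) B far]) (use sides in auto)
  moreover have "norm (contour_integral (linepath a3 a4) ?g) \<le> M * (2 / R) * norm (a4 - a3)"
    by (rule contour_integral_bound_linepath[OF ci(3) B far]) (use sides in auto)
  moreover have "norm (contour_integral (linepath a4 a1) ?g) \<le> M * (2 / R) * norm (a1 - a4)"
    by (rule contour_integral_bound_linepath[OF ci(4) B far]) (use sides in auto)
  moreover have "norm (a3 - a2) = R" "norm (a4 - a3) = 2 * R" "norm (a1 - a4) = R"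
    using R by (simp_all add: a1_def a2_def a3_def a4_def cmod_eq_Re cmod_eq_Im)
  moreover have "M * (2 / R) * R = 2 * M" "M * (2 / R) * (2 * R) = 4 * M"
    using R by simp_all
  ultimately have "norm (contour_integral (linepath a2 a3) ?g) \<le> 2 * M"
     "norm (contour_integral (linepath a3 a4) ?g) \<le> 4 * M"
     "norm (contour_integral (linepath a4 a1) ?g) \<le> 2 * M"
    by simp_all
  then have "norm (contour_integral (linepath a2 a3) ?g) + (norm (contour_integral (linepath a3 a4) ?g)
      + norm (contour_integral (linepath a4 a1) ?g)) \<le> 8 * M"
    by linarith
  then show ?thesis
    unfolding eq norm_minus_cancel
    by (rule order_trans[OF norm_triangle_mono[OF order_refl norm_triangle_ineq]])
qed

text \<open>The contour height \<open>e n\<close> tends to 0 while the width \<open>R n\<close>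
  tends to infinity, so one limit does both: the base integrals converge by dominated convergence,
  and the error \<open>8 * C / sqrt (R n)\<close> vanishes.\<close>

lemma cauchy_half_plane:
  fixes f :: "complex \<Rightarrow> complex" and b :: "real \<Rightarrow> complex"
  assumes hol: "f holomorphic_on {z. Im z > 0}"
    and bd: "\<And>z. Im z > 0 \<Longrightarrow> norm (f z) \<le> C / sqrt (norm z)"
    and [measurable]: "b \<in> borel_measurable borel"
    and lim: "AE x in lborel. ((\<lambda>y. f (Complex x y)) \<longlongrightarrow> b x) (at_right 0)"
    and w: "Im w \<noteq> 0"
  shows "integrable lborel (\<lambda>x. b x / (of_real x - w))"
    and "(LINT x|lborel. b x / (of_real x - w)) = (if Im w > 0 then 2 * pi * \<i> * f w else 0)"
proof -
  \<comment> \<open>Shifts of at most half of \<open>|Im w|\<close> keep the pole \<open>v n\<close>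
    at distance at least \<open>d\<close> from the real axis and on the same side of it as
    \<open>w\<close>.\<close>
  define d where "d = \<bar>Im w\<bar> / 2"
  have d: "d > 0" using w by (simp add: d_def)
  define e where "e n = d / (real n + 1)" for n
  have e: "e n > 0" "e n \<le> d" for n
    using d by (auto simp: e_def field_simps)
  have e0: "e \<longlonglongrightarrow> 0"
    unfolding e_def using d by real_asymp
  \<comment> \<open>The term \<open>4 * norm w\<close> gives \<open>2 * norm (v n) < R n\<close>,
    because \<open>norm (v n) <= norm w + e n <= 2 * norm w\<close>.\<close>
  define R where "R n = real n + 1 + 4 * norm w" for n
  \<comment> \<open>The pole moves down by as much as the function moves up, so the value picked up
    at the pole is \<open>f w\<close> for every \<open>n\<close>.\<close>
  define v where "v n = w - \<i> * e n" for n
  have C: "C \<ge> 0"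
    using order_trans[OF norm_ge_zero bd[of \<i>]] by simp
  have f_bd: "norm (f (z + \<i> * e n)) \<le> C / sqrt (norm z)" if "Im z \<ge> 0" "z \<noteq> 0" for z n
  proof -
    have "norm z \<le> norm (z + \<i> * e n)"
      using that e(1)[of n] by (auto simp: cmod_def intro!: power_mono)
    moreover from this have "z + \<i> * e n \<noteq> 0"
      using that by auto
    ultimately show ?thesis
      using that e(1)[of n] C by (intro order_trans[OF bd] divide_left_mono mult_pos_pos) auto
  qed
  \<comment> \<open>Split \<open>1 + |x| <= (1 + |Re w|) + |x - Re w|\<close>: the constant is
    absorbed by the lower bound \<open>d\<close> on the distance, the rest by the real part. The
    resulting factor does not depend on \<open>n\<close>.\<close>
  have dom: "1 + \<bar>x\<bar> \<le> ((1 + \<bar>Re w\<bar>) / d + 1) * norm (of_real x - v n)" for x n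
  proof -
    have "\<bar>x - Re w\<bar> \<le> norm (of_real x - v n)"
      using abs_Re_le_cmod[of "of_real x - v n"] by (simp add: v_def)
    moreover have "d \<le> \<bar>Im (of_real x - v n)\<bar>"
      using e[of n] by (auto simp: v_def d_def abs_if split: if_splits)
    then have "d \<le> norm (of_real x - v n)"
      using abs_Im_le_cmod[of "of_real x - v n"] by linarith
    then have "(1 + \<bar>Re w\<bar>) / d * d \<le> (1 + \<bar>Re w\<bar>) / d * norm (of_real x - v n)"
      using d by (intro mult_left_mono) auto
    moreover have "(1 + \<bar>Re w\<bar>) / d * d = 1 + \<bar>Re w\<bar>"
      using d by simp
    ultimately show ?thesis
      unfolding distrib_right by linarith
  qed
  define K where "K = C * ((1 + \<bar>Re w\<bar>) / d + 1)"
  define s where "s n x = indicator {- R n..R n} x *\<^sub>R (f (of_real x + \<i> * e n) / (of_real x - v n))" for n x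
  have nz: "of_real x - v n \<noteq> 0" for x n
    using dom[of x n] by auto
  have cont: "continuous_on UNIV (\<lambda>x. f (of_real x + \<i> * e n) / (of_real x - v n))" for n
    using e(1)[of n] nz
    by (intro continuous_intros continuous_on_compose2[OF holomorphic_on_imp_continuous_on[OF hol]]) auto
  have int: "integrable lborel (\<lambda>x. K * (1 / (sqrt \<bar>x\<bar> * (1 + \<bar>x\<bar>))))"
    by (intro integrable_mult_right integrable_inverse_sqrt_times_inverse)
  have meas: "s n \<in> borel_measurable lborel" for n
    using borel_measurable_continuous_onI[OF cont[of n]] unfolding s_def by measurable
  \<comment> \<open>The point 0 is left out because the majorant has the value 0 there.\<close>
  have s_bd: "AE x in lborel. norm (s n x) \<le> K * (1 / (sqrt \<bar>x\<bar> * (1 + \<bar>x\<bar>)))" for n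
    using AE_lborel_singleton[of 0]
  proof eventually_elim
    case (elim x)
    have "norm (s n x) \<le> norm (f (of_real x + \<i> * e n)) * (1 / norm (of_real x - v n))"
      by (auto simp: s_def indicator_def norm_divide)
    also have "\<dots> \<le> (C / sqrt \<bar>x\<bar>) * (((1 + \<bar>Re w\<bar>) / d + 1) / (1 + \<bar>x\<bar>))"
    proof (intro mult_mono)
      show "norm (f (of_real x + \<i> * e n)) \<le> C / sqrt \<bar>x\<bar>"
        using f_bd[of "of_real x" n] elim by simp
      show "1 / norm (of_real x - v n) \<le> ((1 + \<bar>Re w\<bar>) / d + 1) / (1 + \<bar>x\<bar>)"
      proof -
        have "0 < 1 + \<bar>x\<bar>" "0 < norm (of_real x - v n)"
          using nz[of x n] by auto
        then show ?thesis
          using dom[of x n] by (simp add: pos_divide_le_eq pos_le_divide_eq)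
      qed
    qed (use C in auto)
    finally show ?case by (simp add: K_def)
  qed
  have s_lim: "AE x in lborel. (\<lambda>n. s n x) \<longlonglongrightarrow> b x / (of_real x - w)"
    using lim
  proof eventually_elim
    case (elim x)
    have "filterlim e (at_right 0) sequentially"
      using e0 e(1) less_imp_neq[OF e(1), symmetric]
      by (auto simp: filterlim_at intro!: always_eventually)
    from filterlim_compose[OF elim this]
    have "(\<lambda>n. f (of_real x + \<i> * e n)) \<longlonglongrightarrow> b x"
      by (simp add: Complex_eq)
    moreover have "(\<lambda>n. of_real x - v n) \<longlonglongrightarrow> of_real x - (w - \<i> * of_real 0)"
      unfolding v_def by (intro tendsto_intros e0)
    ultimately have "(\<lambda>n. f (of_real x + \<i> * e n) / (of_real x - v n)) \<longlonglongrightarrow> b x / (of_real x - w)"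
      using w by (intro tendsto_divide) (auto simp: complex_eq_iff)
    moreover have "eventually (\<lambda>n. f (of_real x + \<i> * e n) / (of_real x - v n) = s n x) sequentially"
    proof -
      have "filterlim R at_top sequentially"
        unfolding R_def by real_asymp
      then have "eventually (\<lambda>n. \<bar>x\<bar> \<le> R n) sequentially"
        by (simp add: filterlim_at_top)
      then show ?thesis
        by eventually_elim (auto simp: s_def indicator_def)
    qed
    ultimately show ?case
      by (rule Lim_transform_eventually)
  qed
  have meas': "(\<lambda>x. b x / (of_real x - w)) \<in> borel_measurable lborel"
    by measurable
  show "integrable lborel (\<lambda>x. b x / (of_real x - w))"
    by (rule integrable_dominated_convergence[OF meas' meas int s_lim s_bd])
  have 1: "(\<lambda>n. integral\<^sup>L lborel (s n)) \<longlonglongrightarrow> (LINT x|lborel. b x / (of_real x - w))"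
    by (rule integral_dominated_convergence[OF meas' meas int s_lim s_bd])
  have est: "norm (integral\<^sup>L lborel (s n) - (if Im w > 0 then 2 * pi * \<i> * f w else 0))
      \<le> 8 * (C / sqrt (R n))" for n
  proof -
    have "integral\<^sup>L lborel (s n) = integral {-R n..R n} (\<lambda>x. f (of_real x + \<i> * e n) / (of_real x - v n))"
      unfolding s_def
      using set_borel_integral_eq_integral(2)[OF borel_integrable_atLeastAtMost'[OF
          continuous_on_subset[OF cont[of n] subset_UNIV], of "- R n" "R n"]]
      by (simp add: set_lebesgue_integral_def)
    moreover have "norm (integral {-R n..R n} (\<lambda>x. f (of_real x + \<i> * e n) / (of_real x - v n))
      - (if Im (v n) > 0 then 2 * pi * \<i> * f (v n + \<i> * e n) else 0)) \<le> 8 * (C / sqrt (R n))"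
    proof (rule cauchy_rectangle_estimate[where e = "e n" and F = "\<lambda>z. f (z + \<i> * e n)"])
      show "(\<lambda>z. f (z + \<i> * e n)) holomorphic_on {z. Im z > - e n}"
        by (rule holomorphic_on_compose_gen[OF _ hol, unfolded comp_def])
           (auto intro!: holomorphic_intros)
      have "norm (v n) \<le> norm w + e n"
        using norm_triangle_ineq4[of w "\<i> * e n"] e(1)[of n] by (simp add: v_def norm_mult)
      also have "e n \<le> norm w"
        using e(2)[of n] abs_Im_le_cmod[of w] by (simp add: d_def)
      finally show "2 * norm (v n) < R n"
        by (simp add: R_def)
      show "Im (v n) \<noteq> 0"
        using e[of n] w by (auto simp: v_def d_def)
      fix z assume z: "Im z \<ge> 0" "norm z \<ge> R n"
      have "R n > 0" unfolding R_def using norm_ge_zero[of w] by linarith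
      then show "norm (f (z + \<i> * e n)) \<le> C / sqrt (R n)"
        using z C by (intro order_trans[OF f_bd] divide_left_mono mult_pos_pos) auto
    qed (use e in auto)
    moreover have "Im (v n) > 0 \<longleftrightarrow> Im w > 0"
      using e[of n] by (auto simp: v_def d_def abs_if split: if_splits)
    moreover have "v n + \<i> * e n = w"
      by (simp add: v_def)
    ultimately show ?thesis
      by (simp only:)
  qed
  have "(\<lambda>n. 8 * (C / sqrt (R n))) \<longlonglongrightarrow> 0"
    unfolding R_def by real_asymp
  then have "(\<lambda>n. integral\<^sup>L lborel (s n) - (if Im w > 0 then 2 * pi * \<i> * f w else 0)) \<longlonglongrightarrow> 0"
    by (rule Lim_null_comparison[rotated]) (use est in auto)
  then have "(\<lambda>n. integral\<^sup>L lborel (s n)) \<longlonglongrightarrow> (if Im w > 0 then 2 * pi * \<i> * f w else 0)"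
    by (simp add: LIM_zero_iff)
  with 1 show "(LINT x|lborel. b x / (of_real x - w)) = (if Im w > 0 then 2 * pi * \<i> * f w else 0)"
    by (rule LIMSEQ_unique)
qed

lemma half_plane_imaginary_part:
  fixes f :: "complex \<Rightarrow> complex" and b :: "real \<Rightarrow> complex"
  assumes hol: "f holomorphic_on {z. Im z > 0}"
    and bd: "\<And>z. Im z > 0 \<Longrightarrow> norm (f z) \<le> C / sqrt (norm z)"
    and b: "b \<in> borel_measurable borel"
    and lim: "AE x in lborel. ((\<lambda>y. f (Complex x y)) \<longlongrightarrow> b x) (at_right 0)"
    and w: "Im w > 0"
  shows "integrable lborel (\<lambda>x. of_real (Im (b x)) / (of_real x - w))"
    and "f w = (LINT x|lborel. of_real (Im (b x)) / (of_real x - w)) / pi"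
proof -
  note * = cauchy_half_plane[OF hol bd b lim]
  have 1: "integrable lborel (\<lambda>x. b x / (of_real x - w))"
    "(LINT x|lborel. b x / (of_real x - w)) = 2 * pi * \<i> * f w"
    using *[of w] w by auto
  have 2: "integrable lborel (\<lambda>x. b x / (of_real x - cnj w))"
    "(LINT x|lborel. b x / (of_real x - cnj w)) = 0"
    using *[of "cnj w"] w by auto
  have 3: "integrable lborel (\<lambda>x. cnj (b x) / (of_real x - w))"
    using integrable_cnj[OF 2(1)] by simp
  have 4: "(LINT x|lborel. cnj (b x) / (of_real x - w)) = 0"
    using Bochner_Integration.integral_cnj[of lborel "\<lambda>x. b x / (of_real x - cnj w)"] 2(2) by simp
  have eq: "of_real (Im (b x)) / (of_real x - w) =
      (b x / (of_real x - w) - cnj (b x) / (of_real x - w)) * (1 / (2 * \<i>))" for x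
  proof -
    have im: "of_real (Im z) = (z - cnj z) * (1 / (2 * \<i>))" for z
      by (simp add: complex_eq_iff)
    have "(a - c) * k / u = (a / u - c / u) * k" for a c k u :: complex
      by (simp add: diff_divide_distrib left_diff_distrib)
    then show ?thesis
      unfolding im by blast
  qed
  show "integrable lborel (\<lambda>x. of_real (Im (b x)) / (of_real x - w))"
    unfolding eq using 1 3 by (intro integrable_mult_left Bochner_Integration.integrable_diff) auto
  show "f w = (LINT x|lborel. of_real (Im (b x)) / (of_real x - w)) / pi"
    unfolding eq using 1 3 4 by (simp add: Bochner_Integration.integral_diff) (simp add: complex_eq_iff)
qed

section \<open>Growth and boundary values of 1 - G\<close>

text \<open>With \<open>u = Ln (1 + z)\<close>: if \<open>|u| <= 1\<close>, then
  \<open>|z| = |exp u - 1| <= exp 1 * |u| <= 3 * |u|\<close>; otherwise \<open>1 / |u| < 1\<close>.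
  The sum of the two bounds covers both cases.\<close>

lemma inverse_norm_Ln_add_one_le:
  fixes z :: complex
  assumes "z \<noteq> 0" "z \<noteq> -1"
  shows "1 / norm (Ln (1 + z)) \<le> 1 + 3 / norm z"
proof -
  have "1 + z \<noteq> 0"
    using assms(2) by (metis add_eq_0_iff)
  then have e: "exp (Ln (1 + z)) = 1 + z"
    by simp
  show ?thesis
  proof (cases "norm (Ln (1 + z)) \<le> 1")
    case True
    have "norm (exp (Ln (1 + z)) - 1) \<le> exp \<bar>Re (Ln (1 + z))\<bar> * norm (Ln (1 + z))"
      using Taylor_exp[of "Ln (1 + z)" 0] by simp
    also have "\<dots> \<le> 3 * norm (Ln (1 + z))"
    proof (rule mult_right_mono)
      have "exp \<bar>Re (Ln (1 + z))\<bar> \<le> exp 1"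
        using True abs_Re_le_cmod[of "Ln (1 + z)"] by simp
      then show "exp \<bar>Re (Ln (1 + z))\<bar> \<le> 3"
        using exp_le by linarith
    qed simp
    finally have "norm z \<le> 3 * norm (Ln (1 + z))"
      using e by simp
    then have "1 / norm (Ln (1 + z)) \<le> 3 / norm z"
      using assms(1) frac_le[of 3 3 "norm z" "3 * norm (Ln (1 + z))"] by simp
    then show ?thesis by simp
  next
    case False
    then have "1 / norm (Ln (1 + z)) \<le> 1"
      using frac_le[of 1 1 1 "norm (Ln (1 + z))"] by simp
    moreover have "0 \<le> 3 / norm z" by simp
    ultimately show ?thesis by linarith
  qed
qed

lemma Ln_add_one_neq_0:
  fixes z :: complex
  assumes "z \<noteq> 0" "z \<noteq> -1"
  shows "Ln (1 + z) \<noteq> 0"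
proof
  have "1 + z \<noteq> 0"
    using assms(2) by (metis add_eq_0_iff)
  moreover assume "Ln (1 + z) = 0"
  ultimately have "1 + z = 1"
    by (metis exp_Ln exp_zero)
  then show False using assms by simp
qed

lemma norm_Ln_le_abs_ln_add_pi:
  assumes "z \<noteq> 0"
  shows "norm (Ln z) \<le> \<bar>ln (norm z)\<bar> + pi"
  using cmod_le[of "Ln z"] Im_Ln_le_pi[OF assms] mpi_less_Im_Ln[OF assms] Re_Ln[OF assms] by linarith

lemma norm_one_minus_G_le_small:
  assumes "z \<noteq> 0" "z \<noteq> -1" "norm z \<le> 2"
  shows "norm (1 - G z) \<le> 4036 / sqrt (norm z)"
proof -
  define r where "r = norm z"
  \<comment> \<open>Fourth root, so that \<open>\<bar>ln r\<bar> = 4 * \<bar>ln s\<bar>\<close> is \<open>O(1/s)\<close> and its square is \<open>O(1/sqrt r)\<close>.\<close>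
  define s where "s = sqrt (sqrt r)"
  define a where "a = norm (Ln z)"
  have r: "r > 0" "r \<le> 2" using assms by (auto simp: r_def)
  have s: "s > 0" using r by (simp add: s_def)
  have s2: "s\<^sup>2 = sqrt r" using r by (simp add: s_def)
  have "sqrt r \<le> 4"
    using r by (intro real_le_lsqrt) auto
  then have "s\<^sup>2 \<le> 2\<^sup>2" by (simp add: s2)
  then have s_le: "s \<le> 2" by (rule power2_le_imp_le) simp
  have a0: "a \<ge> 0" by (simp add: a_def)
  have "ln r = 4 * ln s"
    using r by (simp add: s_def ln_sqrt)
  moreover have "\<bar>ln s\<bar> \<le> s + 1 / s"
  proof -
    have "ln s \<le> s - 1" "- ln s \<le> 1 / s - 1" "1 / s > 0"
      using ln_le_minus_one[of s] ln_le_minus_one[of "1 / s"] s by (simp_all add: ln_div)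
    then show ?thesis using s by linarith
  qed
  moreover have "s \<le> 4 / s"
    using \<open>s\<^sup>2 \<le> 2\<^sup>2\<close> s by (simp add: le_divide_eq power2_eq_square)
  moreover have one: "1 \<le> 2 / s" using s s_le by simp
  moreover have "a \<le> \<bar>ln r\<bar> + pi"
    using norm_Ln_le_abs_ln_add_pi[OF assms(1)] by (simp add: a_def r_def)
  \<comment> \<open>\<open>4 * |ln s| <= 4 * (4 / s + 1 / s) = 20 / s\<close>, and
    \<open>pi < 4 <= 8 / s\<close>.\<close>
  ultimately have a: "a \<le> 28 / s"
    using pi_less_4 by (simp add: abs_mult)
  have "norm (G z) \<le> (1 + a * (1 + 3 / r)) * r * a"
  proof -
    have "norm (1 - Ln z / Ln (1 + z)) \<le> 1 + norm (Ln z) * (1 / norm (Ln (1 + z)))"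
      using norm_triangle_ineq4[of 1 "Ln z / Ln (1 + z)"] by (simp add: norm_divide)
    also have "\<dots> \<le> 1 + a * (1 + 3 / r)"
      using mult_left_mono[OF inverse_norm_Ln_add_one_le[OF assms(1,2)], of a]
      by (simp add: a_def r_def)
    finally show ?thesis
      unfolding G_def norm_mult a_def[symmetric] r_def[symmetric]
      using r a0 by (intro mult_right_mono) auto
  qed
  also have "\<dots> = r * a + (r + 3) * a\<^sup>2"
    using r by (simp add: field_simps power2_eq_square)
  also have "\<dots> \<le> 2 * (28 / s) + 5 * (28 / s)\<^sup>2"
    using r a a0 s by (intro add_mono mult_mono power_mono) auto
  also have "\<dots> \<le> (2 / s) * (2 * (28 / s)) + 5 * (28 / s)\<^sup>2"
    using mult_right_mono[OF one, of "2 * (28 / s)"] s by simp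
  \<comment> \<open>\<open>4032 = 2 * 2 * 28 + 5 * 28^2\<close>; the summand 1 of
    \<open>1 - G z\<close> adds the remaining 4 of the final constant.\<close>
  finally have "norm (G z) \<le> 4032 / s\<^sup>2"
    by (simp add: power2_eq_square power_divide)
  moreover have "1 \<le> 4 / s\<^sup>2"
    using \<open>s\<^sup>2 \<le> 2\<^sup>2\<close> s by simp
  moreover have "norm (1 - G z) \<le> 1 + norm (G z)"
    using norm_triangle_ineq4[of 1 "G z"] by simp
  ultimately have "norm (1 - G z) \<le> 4 / s\<^sup>2 + 4032 / s\<^sup>2" by linarith
  then show ?thesis
    by (simp add: s2 r_def flip: add_divide_distrib)
qed

text \<open>Both arguments lie strictly between 0 and \<open>pi\<close>, so their difference stays
  in the principal strip and no multiple of \<open>2 * pi * \<i>\<close> appears.\<close>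

lemma Ln_add_one_minus_Ln:
  assumes "Im z > 0"
  shows "Ln (1 + z) - Ln z = Ln (1 + 1 / z)"
proof -
  have nz: "z \<noteq> 0" "1 + z \<noteq> 0"
    using assms by (auto simp: complex_eq_iff)
  have "exp (Ln (1 + z) - Ln z) = 1 + 1 / z"
    using nz by (simp add: exp_diff field_simps)
  then show ?thesis
    using Im_Ln_pos_lt_imp[of z] Im_Ln_pos_lt_imp[of "1 + z"] assms
    by (intro Ln_unique[symmetric]) auto
qed

lemma norm_one_minus_G_le_large:
  assumes "Im z > 0" "norm z \<ge> 2"
  shows "norm (1 - G z) \<le> 12 / norm z"
proof -
  define L where "L = Ln (1 + 1 / z)"
  define B where "B = Ln (1 + z)"
  define r where "r = norm z"
  have r: "r \<ge> 2" using assms by (simp add: r_def)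
  have nz: "z \<noteq> 0" "z \<noteq> -1"
    using assms by (auto simp: complex_eq_iff)
  have B: "1 / norm B \<le> 5 / 2"
    using inverse_norm_Ln_add_one_le[OF nz] r frac_le[of 3 3 2 r] unfolding B_def r_def by simp
  have "B \<noteq> 0"
    using Ln_add_one_neq_0[OF nz] by (simp add: B_def)
  have A: "Ln z = B - L"
    using Ln_add_one_minus_Ln[OF assms(1)] by (simp add: L_def B_def algebra_simps)
  have "norm (L - 1 / z) \<le> (1 / r)\<^sup>2 / (1 - 1 / r)"
  proof -
    have "1 / r < 1" using r by simp
    then show ?thesis
      using Ln_approx_linear[of "1 / z"] by (simp add: L_def norm_divide r_def)
  qed
  also have "\<dots> \<le> (1 / r)\<^sup>2 / (1 / 2)"
    using r by (intro divide_left_mono) auto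
  finally have L1: "norm (L - 1 / z) \<le> 2 / r\<^sup>2"
    by (simp add: power_divide)
  have "norm L \<le> norm (L - 1 / z) + 1 / r"
    using norm_triangle_ineq[of "L - 1 / z" "1 / z"] by (simp add: norm_divide r_def)
  also have "\<dots> \<le> 1 / r + 1 / r"
  proof -
    have "2 / r\<^sup>2 \<le> r / r\<^sup>2"
      using r by (intro divide_right_mono) auto
    also have "\<dots> = 1 / r" by (simp add: power2_eq_square)
    finally show ?thesis using L1 by linarith
  qed
  finally have L: "norm L \<le> 2 / r" by simp
  \<comment> \<open>Substituting \<open>Ln z = B - L\<close> turns \<open>G z\<close> into
    \<open>z * L - z * L^2 / B\<close>. As \<open>L\<close> is \<open>1 / z\<close> up to second
    order, the leading 1 cancels; the two remaining terms are at most \<open>2 / r\<close> and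
    \<open>10 / r\<close>.\<close>
  have "1 - G z = - (z * (L - 1 / z)) + z * L\<^sup>2 / B"
    using \<open>B \<noteq> 0\<close> nz unfolding G_def A B_def[symmetric] by (simp add: field_simps power2_eq_square)
  also have "norm \<dots> \<le> r * norm (L - 1 / z) + r * (norm L)\<^sup>2 * (1 / norm B)"
    by (rule order_trans[OF norm_triangle_ineq]) (simp add: norm_mult norm_divide norm_power r_def)
  also have "\<dots> \<le> r * (2 / r\<^sup>2) + r * (2 / r)\<^sup>2 * (5 / 2)"
    using r L L1 B by (intro add_mono mult_mono power_mono) auto
  also have "\<dots> = 12 / r"
    using r by (simp add: power2_eq_square)
  finally show ?thesis by (simp add: r_def)
qed

lemma norm_one_minus_G_le:
  assumes "Im z > 0"
  shows "norm (1 - G z) \<le> 4036 / sqrt (norm z)"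
proof (cases "norm z \<le> 2")
  case True
  then show ?thesis
    using assms by (intro norm_one_minus_G_le_small) (auto simp: complex_eq_iff)
next
  case False
  then have "sqrt (norm z) * 1 \<le> sqrt (norm z) * sqrt (norm z)"
    by (intro mult_left_mono) auto
  then have "12 / norm z \<le> 4036 / sqrt (norm z)"
    using False by (intro frac_le) auto
  then show ?thesis
    using norm_one_minus_G_le_large[OF assms] False by linarith
qed

lemma holomorphic_one_minus_G:
  "(\<lambda>z. 1 - G z) holomorphic_on - {z. Im z = 0 \<and> Re z \<le> 0}"
proof -
  have "Ln (1 + z) \<noteq> 0" if "\<not> (Im z = 0 \<and> Re z \<le> 0)" for z
    using that by (intro Ln_add_one_neq_0) auto
  then show ?thesis
    unfolding G_def by (intro holomorphic_intros) (auto simp: complex_nonpos_Reals_iff)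
qed

text \<open>Since \<open>Im (Ln x) = pi\<close> for negative \<open>x\<close>, the value of \<open>Ln\<close> on the cut, and with it that of \<open>G\<close>,
  is the boundary value from above.\<close>

lemma tendsto_Ln_from_above:
  assumes "x \<noteq> 0"
  shows "((\<lambda>y. Ln (Complex x y)) \<longlongrightarrow> Ln (of_real x)) (at_right 0)"
proof -
  \<comment> \<open>Both directions of approach are used: \<open>c = \<i>\<close> for positive
    \<open>x\<close>, and \<open>c = -\<i>\<close> after a negative \<open>x\<close> has been
    reflected.\<close>
  have lim: "((\<lambda>y. Ln (of_real t + c * of_real y)) \<longlongrightarrow> Ln (of_real t)) (at_right 0)" if "t > 0" for t c
  proof -
    have "((\<lambda>y. Ln (of_real t + c * of_real y)) \<longlongrightarrow> Ln (of_real t + c * of_real 0)) (at_right 0)"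
      using that by (intro tendsto_intros) auto
    then show ?thesis by simp
  qed
  show ?thesis
  proof (cases "x > 0")
    case True
    then show ?thesis
      using lim[of x \<i>] by (simp add: Complex_eq)
  next
    case False
    then have x: "x < 0" using assms by simp
    \<comment> \<open>Negation carries the approach to the cut from above into an approach to the
      positive axis from below, where \<open>Ln\<close> is continuous; the price is the constant
      \<open>\<i> * pi\<close>.\<close>
    have "((\<lambda>y. Ln (of_real (-x) + (-\<i>) * of_real y) + \<i> * pi) \<longlongrightarrow> Ln (of_real (-x)) + \<i> * pi) (at_right 0)"
      using x by (intro tendsto_intros lim) auto
    moreover have "Ln (of_real (-x)) + \<i> * pi = Ln (of_real x)"
      using x Ln_of_real'[of x] Ln_of_real[of "-x"] by simp
    moreover have "eventually (\<lambda>y. Ln (of_real (-x) + (-\<i>) * of_real y) + \<i> * pi = Ln (Complex x y)) (at_right 0)"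
      using eventually_at_right_less[of 0]
    proof eventually_elim
      case (elim y)
      define u where "u = of_real (-x) + (-\<i>) * complex_of_real y"
      have "Complex x y = - u"
        by (simp add: u_def Complex_eq)
      moreover have "u \<noteq> 0" "Im u < 0"
        using elim x by (auto simp: u_def complex_eq_iff)
      ultimately show ?case
        using Ln_minus[of u] by (simp add: u_def)
    qed
    ultimately show ?thesis
      using Lim_transform_eventually by fastforce
  qed
qed

lemma tendsto_one_minus_G_from_above:
  assumes "x \<noteq> 0" "x \<noteq> -1"
  shows "((\<lambda>y. 1 - G (Complex x y)) \<longlongrightarrow> 1 - G (of_real x)) (at_right 0)"
proof -
  have "((\<lambda>y. Ln (1 + Complex x y)) \<longlongrightarrow> Ln (1 + of_real x)) (at_right 0)"
    using tendsto_Ln_from_above[of "1 + x"] assms by (simp add: Complex_eq add.assoc)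
  moreover have "Ln (1 + complex_of_real x) \<noteq> 0"
    using assms by (intro Ln_add_one_neq_0) (auto simp: complex_eq_iff)
  moreover have "((\<lambda>y. Complex x y) \<longlongrightarrow> of_real x) (at_right 0)"
  proof -
    have "((\<lambda>y. Complex x y) \<longlongrightarrow> Complex x 0) (at_right 0)"
      by (intro tendsto_intros)
    then show ?thesis by (simp add: complex_of_real_def)
  qed
  ultimately show ?thesis
    unfolding G_def using assms
    by (intro tendsto_diff tendsto_mult tendsto_divide tendsto_const tendsto_Ln_from_above)
qed

text \<open>Here the two branches of \<open>\<rho>\<close> arise. For \<open>t < 1\<close> only
  \<open>Ln z\<close> has imaginary part \<open>pi\<close>, and the product of \<open>Ln z\<close>
  with itself produces the term \<open>2 * ln t\<close>. For \<open>t > 1\<close> both logarithms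
  have imaginary part \<open>pi\<close>, which cancels in \<open>Ln (1 + z) - Ln z\<close>; this
  real difference appears once in the first factor of \<open>G\<close> and once in the imaginary
  part of \<open>Ln z / Ln (1 + z)\<close>, hence the square.\<close>

lemma Im_one_minus_G_neg:
  assumes "t > 0" "t \<noteq> 1"
  shows "Im (1 - G (of_real (- t))) = - pi * \<rho> t"
proof -
  define a where "a = ln t"
  define b where "b = ln \<bar>1 - t\<bar>"
  have A: "Ln (of_real (- t)) = Complex a pi"
    using assms Ln_of_real'[of "- t"] by (simp add: a_def complex_eq_iff)
  show ?thesis
  proof (cases "t < 1")
    case True
    have "b < 0" using True assms by (simp add: b_def)
    have B: "Ln (1 + of_real (- t)) = of_real b"
      using True Ln_of_real[of "1 - t"] by (simp add: b_def)
    have "ln ((1 - t) / t\<^sup>2) = b - 2 * a"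
      using True assms by (simp add: a_def b_def ln_div ln_realpow)
    moreover have "\<bar>1 - t\<bar> = 1 - t" using True by simp
    ultimately have rho: "\<rho> t = - (t * (b - 2 * a)) / b"
      using True assms by (simp add: \<rho>_def b_def)
    show ?thesis
      using \<open>b < 0\<close> unfolding G_def A B rho
      by (simp add: field_simps Complex_eq)
  next
    case False
    then have t: "t > 1" using assms by simp
    have B: "Ln (1 + of_real (- t)) = Complex b pi"
      using t Ln_of_real'[of "1 - t"] by (simp add: b_def complex_eq_iff)
    have "ln ((t - 1) / t) = b - a"
      using t by (simp add: a_def b_def ln_div)
    moreover have "\<bar>1 - t\<bar> = t - 1" using t by simp
    ultimately have rho: "\<rho> t = - (t * (b - a)\<^sup>2) / (b\<^sup>2 + pi\<^sup>2)"
      using t by (simp add: \<rho>_def b_def)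
    have "Complex b pi \<noteq> 0" by (simp add: complex_eq_iff)
    moreover have "of_real (b - a) = Complex b pi - Complex a pi"
      by (simp add: complex_eq_iff)
    ultimately have "1 - Complex a pi / Complex b pi = of_real (b - a) / Complex b pi"
      by (metis diff_divide_distrib divide_self)
    moreover have "b\<^sup>2 + pi\<^sup>2 \<noteq> 0"
      by (simp add: sum_power2_eq_zero_iff)
    ultimately show ?thesis
      unfolding G_def A B rho
      by (simp add: Re_divide Im_divide field_simps power2_eq_square)
  qed
qed

section \<open>The Stieltjes representation\<close>

lemma rho_measurable [measurable]: "\<rho> \<in> borel_measurable borel"
  unfolding \<rho>_def [abs_def] by measurable

lemma G_of_real_measurable: "(\<lambda>x. G (complex_of_real x)) \<in> borel_measurable borel"
proof -
  have eq: "Ln (complex_of_real x) = (if x = 0 then Ln 0 else of_real (ln \<bar>x\<bar>) + (if x < 0 then pi else 0) * \<i>)" for x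
    using Ln_of_real'[of x] by auto
  have [measurable]: "(\<lambda>x. Ln (complex_of_real x)) \<in> borel_measurable borel"
    unfolding eq by measurable
  have "(\<lambda>x. Ln (complex_of_real (1 + x))) \<in> borel_measurable borel"
    by measurable
  then have [measurable]: "(\<lambda>x. Ln (1 + complex_of_real x)) \<in> borel_measurable borel"
    by simp
  show ?thesis
    unfolding G_def by measurable
qed

lemma stieltjes_upper:
  assumes w: "Im w > 0"
  shows "integrable lborel (\<lambda>t. of_real (\<rho> t) / (of_real t + w))"
    and "1 - G w = (LINT t|lborel. of_real (\<rho> t) / (of_real t + w))"
proof -
  let ?f = "\<lambda>z. 1 - G z"
  let ?h = "\<lambda>x. of_real (Im (?f (of_real x))) / (of_real x - w)"
  have hol: "?f holomorphic_on {z. Im z > 0}"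
    by (rule holomorphic_on_subset[OF holomorphic_one_minus_G]) auto
  have meas: "(\<lambda>x. ?f (of_real x)) \<in> borel_measurable borel"
    using G_of_real_measurable by measurable
  have lim: "AE x in lborel. ((\<lambda>y. ?f (Complex x y)) \<longlongrightarrow> ?f (of_real x)) (at_right 0)"
    using AE_lborel_singleton[of 0] AE_lborel_singleton[of "-1"]
    by eventually_elim (rule tendsto_one_minus_G_from_above)
  note * = half_plane_imaginary_part[OF hol norm_one_minus_G_le meas lim w]
  have [measurable]: "?h \<in> borel_measurable lborel"
    using *(1) by simp
  \<comment> \<open>Under \<open>x = -t\<close> the sign of \<open>- pi * \<rho> t\<close> cancels
    that of the denominator \<open>- t - w\<close>. For \<open>t < 0\<close> the point
    \<open>x\<close> is positive and both sides vanish.\<close>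
  have ae: "AE t in lborel. ?h (0 + (-1) * t) = pi * (of_real (\<rho> t) / (of_real t + w))"
    using AE_lborel_singleton[of 0] AE_lborel_singleton[of "1"]
  proof eventually_elim
    case (elim t)
    have minus: "x / (- of_real t - w) = - (x / (of_real t + w))" for x
      using divide_minus_right[of x "of_real t + w"] by simp
    show ?case
    proof (cases "t > 0")
      case True
      have "of_real (Im (?f (of_real (0 + (-1) * t)))) = - (complex_of_real pi * of_real (\<rho> t))"
        using Im_one_minus_G_neg[OF True] elim by simp
      then show ?thesis
        by (simp add: minus)
    next
      case False
      then have t: "t < 0" using elim by simp
      have "Im (Ln (1 + of_real (- t))) = 0" "Im (Ln (of_real (- t))) = 0"
        using t Ln_of_real[of "1 - t"] Ln_of_real[of "- t"] by simp_all
      then have "Im (G (of_real (- t))) = 0"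
        unfolding G_def by (simp add: Im_divide)
      moreover have "\<rho> t = 0"
        using t by (simp add: \<rho>_def)
      ultimately show ?thesis by simp
    qed
  qed
  have 1: "integrable lborel (\<lambda>t. ?h (0 + (-1) * t))"
    using lborel_integrable_real_affine[OF *(1), of "-1" 0] by simp
  have "integrable lborel (\<lambda>t. pi * (of_real (\<rho> t) / (of_real t + w)))"
    by (rule Bochner_Integration.integrable_cong_AE[THEN iffD1, OF _ _ ae 1]) measurable
  then have "integrable lborel (\<lambda>t. 1 / of_real pi * (of_real pi * (of_real (\<rho> t) / (of_real t + w))))"
    by (rule integrable_mult_right)
  then show "integrable lborel (\<lambda>t. of_real (\<rho> t) / (of_real t + w))"
    by simp
  have "integral\<^sup>L lborel ?h = (LINT t|lborel. ?h (0 + (-1) * t))"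
    using lborel_integral_real_affine[of "-1" ?h 0] by simp
  also have "\<dots> = (LINT t|lborel. pi * (of_real (\<rho> t) / (of_real t + w)))"
    by (rule integral_cong_AE[OF _ _ ae]) measurable
  also have "\<dots> = pi * (LINT t|lborel. of_real (\<rho> t) / (of_real t + w))"
    by (rule integral_mult_right_zero)
  finally show "1 - G w = (LINT t|lborel. of_real (\<rho> t) / (of_real t + w))"
    using *(2) by simp
qed

section \<open>From the upper half-plane to the right half-plane\<close>

lemma rho_nonpos_arg: "t \<le> 0 \<Longrightarrow> \<rho> t = 0"
  by (simp add: \<rho>_def)

text \<open>Read off from the representation at \<open>w = \<i>\<close>, since
  \<open>|t + \<i>| <= 1 + t\<close>. This weighted integrability dominates every kernel
  \<open>1 / (t + w)\<close> with \<open>Re w > 0\<close>.\<close>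

lemma integrable_rho_over_one_plus: "integrable lborel (\<lambda>t. \<rho> t / (1 + t))"
proof -
  have 1: "integrable lborel (\<lambda>t. of_real (\<rho> t) / (of_real t + \<i>))"
    by (rule stieltjes_upper) simp
  show ?thesis
  proof (rule Bochner_Integration.integrable_bound[OF 1])
    show "AE t in lborel. norm (\<rho> t / (1 + t)) \<le> norm (of_real (\<rho> t) / (of_real t + \<i>))"
    proof (rule AE_I2)
      fix t
      show "norm (\<rho> t / (1 + t)) \<le> norm (of_real (\<rho> t) / (of_real t + \<i>))"
      proof (cases "t > 0")
        case True
        have "norm (of_real t + \<i>) \<le> 1 + t"
          using norm_triangle_ineq[of "of_real t" \<i>] True by simp
        moreover have "of_real t + \<i> \<noteq> 0"
          by (simp add: complex_eq_iff)
        ultimately show ?thesis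
          using True by (auto simp: norm_divide intro!: divide_left_mono mult_pos_pos)
      qed (simp add: rho_nonpos_arg)
    qed
  qed measurable
qed

lemma one_plus_le_norm_add:
  assumes "t \<ge> 0" "Re w > 0"
  shows "min 1 (Re w) * (1 + t) \<le> norm (of_real t + w)"
proof -
  have "min 1 (Re w) * t \<le> 1 * t"
    using assms by (intro mult_right_mono) auto
  then have "min 1 (Re w) * (1 + t) \<le> t + Re w"
    using min.cobounded2[of 1 "Re w"] unfolding distrib_left by linarith
  also have "\<dots> \<le> norm (of_real t + w)"
    using complex_Re_le_cmod[of "of_real t + w"] by simp
  finally show ?thesis .
qed

text \<open>The constant \<open>c\<close> is kept apart from \<open>Re w\<close> so that one
  majorant serves a whole sequence of points.\<close>

lemma norm_rho_over_add_le:
  assumes "c > 0" "c \<le> 1" "c \<le> Re w"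
  shows "norm (of_real (\<rho> t) / (of_real t + w)) \<le> \<bar>\<rho> t / (1 + t)\<bar> / c"
proof (cases "t > 0")
  case True
  have "c * (1 + t) \<le> min 1 (Re w) * (1 + t)"
    using True assms by (intro mult_right_mono) auto
  also have "\<dots> \<le> norm (of_real t + w)"
    using True assms by (intro one_plus_le_norm_add) auto
  finally have "\<bar>\<rho> t\<bar> / norm (of_real t + w) \<le> \<bar>\<rho> t\<bar> / (c * (1 + t))"
    using True assms by (intro frac_le) auto
  then show ?thesis
    using True by (simp add: norm_divide mult.commute)
qed (simp add: rho_nonpos_arg)

lemma integrable_stieltjes:
  assumes "Re w > 0"
  shows "integrable lborel (\<lambda>t. of_real (\<rho> t) / (of_real t + w))"
proof (rule Bochner_Integration.integrable_bound)
  show "integrable lborel (\<lambda>t. \<bar>\<rho> t / (1 + t)\<bar> / min 1 (Re w))"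
    by (intro integrable_divide integrable_abs integrable_rho_over_one_plus)
  show "AE t in lborel. norm (of_real (\<rho> t) / (of_real t + w)) \<le> norm (\<bar>\<rho> t / (1 + t)\<bar> / min 1 (Re w))"
    using assms norm_rho_over_add_le[of "min 1 (Re w)" w] by simp
qed measurable

text \<open>Continuity of the transform brings the representation to positive real \<open>w\<close>,
  which lie on the boundary of the upper half-plane and are approached from above.\<close>

lemma stieltjes_tendsto:
  fixes u :: "nat \<Rightarrow> complex"
  assumes "c > 0" "c \<le> 1" "\<And>n. c \<le> Re (u n)" "u \<longlonglongrightarrow> w"
  shows "(\<lambda>n. LINT t|lborel. of_real (\<rho> t) / (of_real t + u n))
      \<longlonglongrightarrow> (LINT t|lborel. of_real (\<rho> t) / (of_real t + w))"
proof (rule integral_dominated_convergence)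
  show "integrable lborel (\<lambda>t. \<bar>\<rho> t / (1 + t)\<bar> / c)"
    by (intro integrable_divide integrable_abs integrable_rho_over_one_plus)
  show "AE t in lborel. norm (of_real (\<rho> t) / (of_real t + u n)) \<le> \<bar>\<rho> t / (1 + t)\<bar> / c" for n
    using assms by (intro AE_I2 norm_rho_over_add_le)
  have "c \<le> Re w"
    by (rule LIMSEQ_le_const[OF tendsto_Re[OF assms(4)]]) (use assms in auto)
  show "AE t in lborel. (\<lambda>n. of_real (\<rho> t) / (of_real t + u n)) \<longlonglongrightarrow> of_real (\<rho> t) / (of_real t + w)"
  proof (rule AE_I2)
    fix t
    show "(\<lambda>n. of_real (\<rho> t) / (of_real t + u n)) \<longlonglongrightarrow> of_real (\<rho> t) / (of_real t + w)"
    proof (cases "t > 0")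
      case True
      then have "of_real t + w \<noteq> 0"
        using \<open>c \<le> Re w\<close> \<open>c > 0\<close> by (auto simp: complex_eq_iff)
      then show ?thesis
        by (intro tendsto_intros assms)
    qed (simp add: rho_nonpos_arg)
  qed
qed measurable

lemma G_cnj:
  assumes "Re z > 0"
  shows "G (cnj z) = cnj (G z)"
proof -
  have "Ln (cnj z) = cnj (Ln z)" "Ln (1 + cnj z) = cnj (Ln (1 + z))"
    using assms cnj_Ln[of z] cnj_Ln[of "1 + z"] by (auto simp: complex_nonpos_Reals_iff)
  then show ?thesis
    by (simp add: G_def)
qed

lemma stieltjes_representation:
  assumes "Re w > 0"
  shows "1 - G w = (LINT t|lborel. of_real (\<rho> t) / (of_real t + w))"
proof (cases "Im w" "0 :: real" rule: linorder_cases)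
  case less
  have "1 - G w = cnj (1 - G (cnj w))"
    using G_cnj[of "cnj w"] assms by simp
  also have "\<dots> = cnj (LINT t|lborel. of_real (\<rho> t) / (of_real t + cnj w))"
    using less by (subst stieltjes_upper(2)) auto
  also have "\<dots> = (LINT t|lborel. of_real (\<rho> t) / (of_real t + w))"
    by (subst Bochner_Integration.integral_cnj [symmetric]) simp
  finally show ?thesis .
next
  case greater
  then show ?thesis by (rule stieltjes_upper)
next
  case equal
  define u where "u n = w + \<i> * of_real (1 / real (Suc n))" for n
  have "(\<lambda>n. w + \<i> * of_real (1 / real (Suc n))) \<longlonglongrightarrow> w + \<i> * of_real 0"
    by (intro tendsto_intros LIMSEQ_Suc lim_1_over_n)
  then have u: "u \<longlonglongrightarrow> w"
    by (simp add: u_def [abs_def])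
  have "isCont (\<lambda>z. 1 - G z) w"
  proof (rule continuous_on_interior[OF holomorphic_on_imp_continuous_on])
    show "(\<lambda>z. 1 - G z) holomorphic_on {z. Re z > 0}"
      by (rule holomorphic_on_subset[OF holomorphic_one_minus_G]) auto
    show "w \<in> interior {z. Re z > 0}"
      using assms by (subst interior_open) (auto simp: open_halfspace_Re_gt)
  qed
  then have "(\<lambda>n. 1 - G (u n)) \<longlonglongrightarrow> 1 - G w"
    by (rule isCont_tendsto_compose) (rule u)
  moreover have "(\<lambda>n. LINT t|lborel. of_real (\<rho> t) / (of_real t + u n))
      \<longlonglongrightarrow> (LINT t|lborel. of_real (\<rho> t) / (of_real t + w))"
    using assms by (intro stieltjes_tendsto[where c = "min 1 (Re w)"] u) (auto simp: u_def)
  moreover have "1 - G (u n) = (LINT t|lborel. of_real (\<rho> t) / (of_real t + u n))" for n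
    using equal by (intro stieltjes_upper) (simp add: u_def)
  ultimately show ?thesis
    using LIMSEQ_unique by simp
qed

section \<open>Integral and Laplace transform of the density\<close>

text \<open>For \<open>t < 1\<close> the sign is that of \<open>ln ((1 - t) / t^2)\<close>, which
  changes where \<open>t^2 = 1 - t\<close>, that is at \<open>(sqrt 5 - 1) / 2\<close>; for
  \<open>t > 1\<close> the density is minus a square over a positive number.\<close>

lemma rho_single_sign_change:
  obtains t0 where "t0 > 0" "\<And>t. t \<le> t0 \<Longrightarrow> \<rho> t \<ge> 0" "\<And>t. t \<ge> t0 \<Longrightarrow> \<rho> t \<le> 0"
proof -
  define t0 where "t0 = (sqrt 5 - 1) / 2"
  have s5: "(sqrt 5)\<^sup>2 = 5" "sqrt 5 > 1" by simp_all
  have "sqrt 5 < 3" by (rule real_less_lsqrt) auto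
  then have t0: "t0 > 0" "t0 < 1"
    using s5 by (auto simp: t0_def)
  have root: "t0\<^sup>2 = 1 - t0"
    using s5(1) by (simp add: t0_def power2_eq_square field_simps)
  have nonneg: "\<rho> t \<ge> 0" if "t \<le> t0" for t
  proof (cases "t > 0")
    case True
    then have t: "0 < t" "t < 1" using that t0 by auto
    have "t\<^sup>2 \<le> t0\<^sup>2"
      using that True by (intro power_mono) auto
    then have "1 \<le> (1 - t) / t\<^sup>2"
      using root that t by simp
    then have "0 \<le> t * ln ((1 - t) / t\<^sup>2)"
      using t by simp
    moreover have "ln (1 - t) < 0"
      using t by simp
    ultimately show ?thesis
      using t by (simp add: \<rho>_def divide_nonneg_neg)
  qed (simp add: \<rho>_def)
  have nonpos: "\<rho> t \<le> 0" if "t \<ge> t0" for t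
  proof (cases t "1 :: real" rule: linorder_cases)
    case less
    then have t: "0 < t" "t < 1" using that t0 by auto
    have "t0\<^sup>2 \<le> t\<^sup>2"
      using that t0 by (intro power_mono) auto
    then have "1 - t \<le> t\<^sup>2"
      using root that by simp
    then have "(1 - t) / t\<^sup>2 \<le> 1"
      using t by simp
    moreover have "0 < (1 - t) / t\<^sup>2"
      using t by simp
    ultimately have "ln ((1 - t) / t\<^sup>2) \<le> 0"
      by (simp only: ln_le_zero_iff)
    then have "t * ln ((1 - t) / t\<^sup>2) \<le> 0"
      using t by (simp add: mult_nonneg_nonpos)
    moreover have "ln (1 - t) < 0"
      using t by simp
    ultimately show ?thesis
      using t by (simp add: \<rho>_def divide_nonpos_neg)
  next
    case greater
    then show ?thesis
      unfolding \<rho>_def by (simp add: divide_nonpos_nonneg)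
  qed (simp add: \<rho>_def)
  show ?thesis
    using that t0(1) nonneg nonpos by blast
qed

lemma G_of_real_pos:
  assumes "x > 0"
  shows "G (of_real x) = of_real ((1 - ln x / ln (1 + x)) * x * ln x)"
  using assms Ln_of_real[of x] Ln_of_real[of "1 + x"] by (simp add: G_def)

lemma real_stieltjes:
  assumes "x > 0"
  shows "integrable lborel (\<lambda>t. \<rho> t / (t + x))"
    and "(LINT t|lborel. \<rho> t / (t + x)) = 1 - (1 - ln x / ln (1 + x)) * x * ln x"
proof -
  have int: "integrable lborel (\<lambda>t. complex_of_real (\<rho> t / (t + x)))"
    using integrable_stieltjes[of "of_real x"] assms by simp
  then show "integrable lborel (\<lambda>t. \<rho> t / (t + x))"
    by (simp only: complex_of_real_integrable_eq)
  have "complex_of_real (LINT t|lborel. \<rho> t / (t + x)) = (LINT t|lborel. complex_of_real (\<rho> t / (t + x)))"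
    by (simp only: integral_complex_of_real)
  also have "\<dots> = 1 - G (of_real x)"
    using stieltjes_representation[of "of_real x"] assms by simp
  also have "\<dots> = of_real (1 - (1 - ln x / ln (1 + x)) * x * ln x)"
    using assms by (simp add: G_of_real_pos)
  finally show "(LINT t|lborel. \<rho> t / (t + x)) = 1 - (1 - ln x / ln (1 + x)) * x * ln x"
    by (simp only: of_real_eq_iff)
qed

text \<open>Multiplied by \<open>x\<close>, the Stieltjes formula has the kernel
  \<open>x / (t + x)\<close>, which increases to 1 as \<open>x\<close> tends to infinity, while
  \<open>x * (1 - G x)\<close> tends to 1/2. The single sign change splits \<open>\<rho>\<close>
  into a positive part on a bounded interval and a negative tail.\<close>

lemma rho_integrable: "integrable lborel \<rho>"
  and rho_integral: "integral\<^sup>L lborel \<rho> = 1 / 2"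
proof -
  obtain t0 where t0: "t0 > 0" and nonneg: "\<And>t. t \<le> t0 \<Longrightarrow> \<rho> t \<ge> 0" and nonpos: "\<And>t. t \<ge> t0 \<Longrightarrow> \<rho> t \<le> 0"
    using rho_single_sign_change by blast
  define x where "x n = real n + 1" for n
  have x: "x n > 0" for n by (simp add: x_def)
  define k where "k n t = x n / (t + x n)" for n t
  have int: "integrable lborel (\<lambda>t. \<rho> t * k n t)" for n
    using integrable_mult_right[OF real_stieltjes(1)[OF x], of "x n" n] by (simp add: k_def mult.commute)
  have "(\<lambda>n. x n * (1 - (1 - ln (x n) / ln (1 + x n)) * x n * ln (x n))) \<longlonglongrightarrow> 1 / 2"
  proof -
    define d where "d n = ln (1 + x n) - ln (x n)" for n
    \<comment> \<open>Substituting \<open>ln x = ln (1 + x) - d\<close> isolates the cancellation of the leading terms.\<close>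
    have "(\<lambda>n. x n * (1 - x n * d n) + (x n * d n)\<^sup>2 * (1 / ln (1 + x n))) \<longlonglongrightarrow> 1 / 2 + 1\<^sup>2 * 0"
      unfolding d_def x_def by (intro tendsto_add tendsto_mult tendsto_power; real_asymp)
    moreover have "x n * (1 - x n * d n) + (x n * d n)\<^sup>2 * (1 / ln (1 + x n)) =
        x n * (1 - (1 - ln (x n) / ln (1 + x n)) * x n * ln (x n))" for n
    proof -
      have "ln (1 + x n) > 0" using x[of n] by simp
      moreover have "ln (x n) = ln (1 + x n) - d n" by (simp add: d_def)
      ultimately show ?thesis
        by (simp add: divide_simps) (simp add: algebra_simps power2_eq_square)
    qed
    ultimately show ?thesis by simp
  qed
  moreover have "(LINT t|lborel. \<rho> t * k n t) = x n * (1 - (1 - ln (x n) / ln (1 + x n)) * x n * ln (x n))" for n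
    using real_stieltjes(2)[OF x, of n] integral_mult_right_zero[of lborel "x n" "\<lambda>t. \<rho> t / (t + x n)"]
    by (simp add: k_def mult.commute)
  ultimately have lim: "(\<lambda>n. LINT t|lborel. \<rho> t * k n t) \<longlonglongrightarrow> 1 / 2"
    by simp
  have k_lim: "(\<lambda>n. k n t) \<longlonglongrightarrow> 1" for t
    unfolding k_def x_def by real_asymp
  have k_mono: "k m t \<le> k n t" if "m \<le> n" "t \<ge> 0" for m n t
  proof -
    have "k n t = 1 - t / (t + x n)" for n
      using x[of n] that by (simp add: k_def field_simps)
    moreover have "t / (t + x n) \<le> t / (t + x m)"
      using that by (intro divide_left_mono mult_pos_pos) (auto simp: x_def)
    ultimately show ?thesis by simp
  qed
  have k_bd: "0 \<le> k n t" "k n t \<le> 1" if "t \<ge> 0" for n t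
    using x[of n] that by (auto simp: k_def)
  \<comment> \<open>The integrability of the negative part of \<open>\<rho>\<close> comes out of monotone convergence, because the
    limit of the integrals is already known.\<close>
  let ?p = "\<lambda>t. \<rho> t * indicator {0..t0} t" and ?q = "\<lambda>t. - \<rho> t * indicator {t0<..} t"
  \<comment> \<open>On \<open>[0, t0]\<close> the weight \<open>1 / (1 + t)\<close> is at least
    \<open>1 / (1 + t0)\<close>, so weighted integrability is enough.\<close>
  have p: "integrable lborel ?p"
  proof (rule Bochner_Integration.integrable_bound)
    show "integrable lborel (\<lambda>t. (1 + t0) * (\<rho> t / (1 + t)))"
      by (intro integrable_mult_right integrable_rho_over_one_plus)
    show "AE t in lborel. norm (?p t) \<le> norm ((1 + t0) * (\<rho> t / (1 + t)))"
    proof (rule AE_I2)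
      fix t
      have "\<bar>\<rho> t\<bar> * (1 + t) \<le> \<bar>\<rho> t\<bar> * (1 + t0)" if "t \<le> t0"
        using that by (intro mult_left_mono) auto
      then show "norm (?p t) \<le> norm ((1 + t0) * (\<rho> t / (1 + t)))"
        using t0 by (auto simp: indicator_def abs_mult abs_divide pos_le_divide_eq mult.commute)
    qed
  qed measurable
  have p_lim: "(\<lambda>n. LINT t|lborel. ?p t * k n t) \<longlonglongrightarrow> integral\<^sup>L lborel ?p"
  proof (rule integral_dominated_convergence[where w = "\<lambda>t. norm (?p t)"])
    show "AE t in lborel. norm (?p t * k n t) \<le> norm (?p t)" for n
      using k_bd by (intro AE_I2) (auto simp: indicator_def abs_mult mult_left_le)
    show "AE t in lborel. (\<lambda>n. ?p t * k n t) \<longlonglongrightarrow> ?p t"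
      using tendsto_mult_left[OF k_lim] by simp
  qed (use p in \<open>auto simp: k_def\<close>)
  have decomp: "?p t * k n t - \<rho> t * k n t = ?q t * k n t" for n t
    using t0 by (auto simp: indicator_def rho_nonpos_arg)
  have pk: "integrable lborel (\<lambda>t. ?p t * k n t)" for n
    by (rule Bochner_Integration.integrable_bound[OF int[of n]])
       (auto simp: indicator_def k_def)
  have qk: "integrable lborel (\<lambda>t. ?q t * k n t)" for n
    unfolding decomp[symmetric] by (intro Bochner_Integration.integrable_diff pk int)
  have "(LINT t|lborel. ?q t * k n t) = (LINT t|lborel. ?p t * k n t) - (LINT t|lborel. \<rho> t * k n t)" for n
    unfolding decomp[symmetric] by (intro Bochner_Integration.integral_diff pk int)
  then have q_lim: "(\<lambda>n. LINT t|lborel. ?q t * k n t) \<longlonglongrightarrow> integral\<^sup>L lborel ?p - 1 / 2"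
    using tendsto_diff[OF p_lim lim] by simp
  have q_mono: "AE t in lborel. mono (\<lambda>n. ?q t * k n t)"
  proof (rule AE_I2, rule monoI)
    fix t :: real and m n :: nat assume "m \<le> n"
    then show "?q t * k m t \<le> ?q t * k n t"
      using k_mono[of m n t] nonpos[of t] t0 by (auto simp: indicator_def intro: mult_left_mono_neg)
  qed
  have q_ptw: "AE t in lborel. (\<lambda>n. ?q t * k n t) \<longlonglongrightarrow> ?q t"
  proof (rule AE_I2)
    show "(\<lambda>n. ?q t * k n t) \<longlonglongrightarrow> ?q t" for t
      using tendsto_mult_left[OF k_lim[of t], of "?q t"] by simp
  qed
  have q_meas: "?q \<in> borel_measurable lborel" by measurable
  have q: "integrable lborel ?q" "integral\<^sup>L lborel ?q = integral\<^sup>L lborel ?p - 1 / 2"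
    by (rule integrable_monotone_convergence[OF qk q_mono q_ptw q_lim q_meas]
        integral_monotone_convergence[OF qk q_mono q_ptw q_lim q_meas])+
  have eq: "\<rho> = (\<lambda>t. ?p t - ?q t)"
    using t0 by (auto simp: fun_eq_iff indicator_def rho_nonpos_arg)
  show "integrable lborel \<rho>"
    by (subst eq) (intro Bochner_Integration.integrable_diff p q)
  show "integral\<^sup>L lborel \<rho> = 1 / 2"
    by (subst eq) (use p q in \<open>simp add: Bochner_Integration.integral_diff\<close>)
qed

text \<open>The dummy value 0 of \<open>\<rho>\<close> on the nonpositive axis lets the integral run
  over the whole line.\<close>

lemma phi_eq: "\<phi> s = (LINT t|lborel. exp (- s * t) * \<rho> t)"
  unfolding \<phi>_def set_lebesgue_integral_def
  by (rule Bochner_Integration.integral_cong) (auto simp: indicator_def rho_nonpos_arg)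

lemma integrable_exp_times_rho:
  assumes "s \<ge> 0"
  shows "integrable lborel (\<lambda>t. exp (- s * t) * \<rho> t)"
proof (rule Bochner_Integration.integrable_bound[OF rho_integrable])
  show "AE t in lborel. norm (exp (- s * t) * \<rho> t) \<le> norm (\<rho> t)"
  proof (rule AE_I2)
    fix t
    show "norm (exp (- s * t) * \<rho> t) \<le> norm (\<rho> t)"
      using assms by (cases "t > 0") (auto simp: abs_mult rho_nonpos_arg mult_left_le_one_le)
  qed
qed measurable

text \<open>The comparison is pointwise: \<open>exp (- s * t) - exp (- s * t0)\<close> and
  \<open>\<rho> t\<close> never have opposite signs, on either side of \<open>t0\<close>.\<close>

lemma phi_pos:
  assumes "s \<ge> 0"
  shows "\<phi> s > 0"
proof -
  obtain t0 where t0: "t0 > 0" and nonneg: "\<And>t. t \<le> t0 \<Longrightarrow> \<rho> t \<ge> 0" and nonpos: "\<And>t. t \<ge> t0 \<Longrightarrow> \<rho> t \<le> 0"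
    using rho_single_sign_change by blast
  have "exp (- s * t0) * (1 / 2) = (LINT t|lborel. exp (- s * t0) * \<rho> t)"
    by (simp add: rho_integral)
  also have "\<dots> \<le> \<phi> s"
    unfolding phi_eq
  proof (rule integral_mono)
    fix t
    show "exp (- s * t0) * \<rho> t \<le> exp (- s * t) * \<rho> t"
    proof (cases "t \<le> t0")
      case True
      then have "exp (- s * t0) \<le> exp (- s * t)"
        using assms by (simp add: mult_left_mono)
      then show ?thesis
        using nonneg[OF True] by (rule mult_right_mono)
    next
      case False
      then have "exp (- s * t) \<le> exp (- s * t0)"
        using assms by (simp add: mult_left_mono)
      then show ?thesis
        using nonpos[of t] False by (intro mult_right_mono_neg) auto
    qed
  qed (use assms rho_integrable integrable_exp_times_rho in auto)
  finally show ?thesis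
    by (rule less_le_trans[rotated]) simp
qed

section \<open>Laplace integrals of exponentials and the exchange of integrations\<close>

lemma exp_laplace_real:
  fixes a :: real
  assumes "a > 0"
  shows "set_integrable lborel {0<..} (\<lambda>s. exp (- a * s))"
    and "(LINT s:{0<..}|lborel. exp (- a * s)) = 1 / a"
proof -
  have lim0: "(((\<lambda>s. - exp (- a * s) / a) \<circ> real_of_ereal) \<longlongrightarrow> - inverse a) (at_right 0)"
    unfolding zero_ereal_def ereal_tendsto_simps using assms by real_asymp
  have lim: "(((\<lambda>s. - exp (- a * s) / a) \<circ> real_of_ereal) \<longlongrightarrow> 0) (at_left \<infinity>)"
    unfolding ereal_tendsto_simps using assms by real_asymp
  have deriv: "((\<lambda>s. - exp (- a * s) / a) has_real_derivative exp (- a * x)) (at x)" for x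
    using assms by (auto intro!: derivative_eq_intros)
  note FTC = interval_integral_FTC_nonneg[OF _ deriv _ _ lim0 lim]
  have "einterval 0 \<infinity> = {0::real<..}"
    by (auto simp: einterval_def)
  then show "set_integrable lborel {0<..} (\<lambda>s. exp (- a * s))"
    using FTC(1) by simp
  show "(LINT s:{0<..}|lborel. exp (- a * s)) = 1 / a"
    using FTC(2) by (simp add: interval_lebesgue_integral_0_infty inverse_eq_divide)
qed

text \<open>The modulus of the integrand is \<open>exp (- Re a * s)\<close>, which reduces both
  integrability and the vanishing of the antiderivative at infinity to the real case.\<close>

lemma exp_laplace_complex:
  fixes a :: complex
  assumes "Re a > 0"
  shows "set_integrable lborel {0<..} (\<lambda>s::real. exp (- a * of_real s))"
    and "(LINT s:{0<..}|lborel. exp (- a * of_real s)) = 1 / a"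
proof -
  have ei: "einterval 0 \<infinity> = {0::real<..}"
    by (auto simp: einterval_def)
  show int: "set_integrable lborel {0<..} (\<lambda>s::real. exp (- a * of_real s))"
    unfolding set_integrable_def
  proof (rule Bochner_Integration.integrable_bound)
    show "integrable lborel (\<lambda>s. indicator {0<..} s *\<^sub>R exp (- Re a * s))"
      using exp_laplace_real(1)[OF assms] unfolding set_integrable_def .
    show "AE s in lborel. norm (indicator {0<..} s *\<^sub>R exp (- a * complex_of_real s))
        \<le> norm (indicator {0<..} s *\<^sub>R exp (- Re a * s))"
      by (intro AE_I2) (auto simp: indicator_def norm_exp_eq_Re)
  qed measurable
  have "a \<noteq> 0" using assms by auto
  have "(LBINT s=0..\<infinity>. exp (- a * of_real s)) = 0 - (- 1 / a)"
  proof (rule interval_integral_FTC_integrable[where F = "\<lambda>s. - exp (- a * of_real s) / a"])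
    show "((\<lambda>s. - exp (- a * of_real s) / a) has_vector_derivative exp (- a * of_real x)) (at x)" for x
      using \<open>a \<noteq> 0\<close> by (auto intro!: derivative_eq_intros has_vector_derivative_real_field simp: field_simps)
    show "set_integrable lborel (einterval 0 \<infinity>) (\<lambda>s. exp (- a * of_real s))"
      using int unfolding ei .
    have "((\<lambda>s. - exp (- a * of_real s) / a) \<longlongrightarrow> - exp (- a * of_real 0) / a) (at_right 0)"
      using \<open>a \<noteq> 0\<close> by (intro tendsto_intros)
    then show "(((\<lambda>s. - exp (- a * of_real s) / a) \<circ> real_of_ereal) \<longlongrightarrow> - 1 / a) (at_right 0)"
      unfolding zero_ereal_def ereal_tendsto_simps by simp
    have "((\<lambda>s. exp (- Re a * s)) \<longlongrightarrow> 0) at_top"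
      using assms by real_asymp
    then have "((\<lambda>s. exp (- a * of_real s)) \<longlongrightarrow> 0) at_top"
      by (rule Lim_null_comparison[rotated]) (simp add: norm_exp_eq_Re)
    then have "((\<lambda>s. - exp (- a * of_real s) / a) \<longlongrightarrow> - 0 / a) at_top"
      using \<open>a \<noteq> 0\<close> by (intro tendsto_intros)
    then show "(((\<lambda>s. - exp (- a * of_real s) / a) \<circ> real_of_ereal) \<longlongrightarrow> 0) (at_left \<infinity>)"
      unfolding ereal_tendsto_simps by simp
  qed (auto intro!: continuous_intros)
  then show "(LINT s:{0<..}|lborel. exp (- a * of_real s)) = 1 / a"
    by (simp add: interval_lebesgue_integral_0_infty)
qed

text \<open>Integrating \<open>h t s\<close> over \<open>s\<close> first gives the Stieltjes
  integrand, over \<open>t\<close> first the Laplace integrand. Fubini applies because the integral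
  of \<open>|h t s|\<close> over \<open>s\<close> is \<open>|\<rho> t / (t + Re z)|\<close>,
  integrable by the real Stieltjes formula at the point \<open>Re z\<close>.\<close>

lemma laplace_phi:
  assumes z: "Re z > 0"
  shows "set_integrable lborel {0<..} (\<lambda>s::real. exp (- z * of_real s) * of_real (\<phi> s))"
    and "(LINT s:{0<..}|lborel. exp (- z * of_real s) * of_real (\<phi> s)) = 1 - G z"
proof -
  \<comment> \<open>Only \<open>s\<close> carries an indicator; \<open>\<rho>\<close> itself cuts
    off \<open>t <= 0\<close>.\<close>
  define h where "h t s = complex_of_real (\<rho> t) * (indicator {0<..} s *\<^sub>R exp (- (of_real t + z) * complex_of_real s))" for t s :: real
  have h_meas: "case_prod h \<in> borel_measurable (lborel \<Otimes>\<^sub>M lborel)"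
    unfolding h_def by measurable
  have h_t: "integrable lborel (h t) \<and> integral\<^sup>L lborel (h t) = of_real (\<rho> t) / (of_real t + z)" for t
  proof (cases "t > 0")
    case True
    then have "Re (of_real t + z) > 0" using z by simp
    from exp_laplace_complex[OF this] show ?thesis
      unfolding h_def [abs_def] set_integrable_def set_lebesgue_integral_def
      by (intro conjI integrable_mult_right) (simp_all only: integral_mult_right_zero, simp_all)
  next
    case False
    then have "h t = (\<lambda>s. 0)" by (simp add: h_def [abs_def] rho_nonpos_arg)
    then show ?thesis using False by (simp add: rho_nonpos_arg)
  qed
  have norm_h: "(LINT s|lborel. norm (h t s)) = \<bar>\<rho> t / (t + Re z)\<bar>" for t
  proof (cases "t > 0")
    case True
    have "norm (h t s) = \<bar>\<rho> t\<bar> * (indicator {0<..} s *\<^sub>R exp (- (t + Re z) * s))" for s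
      by (auto simp: h_def norm_mult norm_exp_eq_Re indicator_def)
    then show ?thesis
      using True z exp_laplace_real(2)[of "t + Re z"] unfolding set_lebesgue_integral_def
      by (simp only: integral_mult_right_zero, simp add: abs_divide)
  qed (simp add: h_def rho_nonpos_arg)
  have int: "integrable (lborel \<Otimes>\<^sub>M lborel) (case_prod h)"
  proof (rule lborel_pair.Fubini_integrable[OF h_meas])
    show "integrable lborel (\<lambda>t. LINT s|lborel. norm (case_prod h (t, s)))"
      using integrable_abs[OF real_stieltjes(1)[OF z]] by (simp add: norm_h)
    show "AE t in lborel. integrable lborel (\<lambda>s. case_prod h (t, s))"
      using h_t by simp
  qed
  have h_s: "(LINT t|lborel. h t s) = indicator {0<..} s *\<^sub>R (exp (- z * of_real s) * of_real (\<phi> s))" for s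
  proof -
    have "h t s = (indicator {0<..} s *\<^sub>R exp (- z * of_real s)) * of_real (exp (- s * t) * \<rho> t)" for t
    proof -
      have "- (of_real t + z) * of_real s = - z * of_real s + complex_of_real (- s * t)"
        by (simp add: algebra_simps)
      then have "exp (- (of_real t + z) * of_real s) = exp (- z * of_real s) * complex_of_real (exp (- s * t))"
        by (simp only: exp_add exp_of_real)
      then show ?thesis
        by (simp add: h_def)
    qed
    then have "(LINT t|lborel. h t s) = (indicator {0<..} s *\<^sub>R exp (- z * of_real s)) * of_real (\<phi> s)"
      by (simp only: integral_mult_right_zero integral_complex_of_real phi_eq)
    then show ?thesis by simp
  qed
  show "set_integrable lborel {0<..} (\<lambda>s::real. exp (- z * of_real s) * of_real (\<phi> s))"
    using lborel_pair.integrable_snd[OF int] unfolding set_integrable_def h_s .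
  have "(LINT s|lborel. LINT t|lborel. h t s) = (LINT t|lborel. of_real (\<rho> t) / (of_real t + z))"
    using lborel_pair.Fubini_integral[OF int] h_t by simp
  then show "(LINT s:{0<..}|lborel. exp (- z * of_real s) * of_real (\<phi> s)) = 1 - G z"
    unfolding set_lebesgue_integral_def h_s stieltjes_representation[OF z] .
qed

theorem theorem1p2:
  shows "(\<forall>z::complex. Re z > 0 \<longrightarrow>
            set_integrable lborel {0<..} (\<lambda>s::real. exp (- z * of_real s) * of_real (\<phi> s)) \<and>
            1 - G z = (LINT s:{0<..}|lborel. exp (- z * of_real s) * of_real (\<phi> s))) \<and>
         (\<forall>s\<ge>0. \<phi> s > 0)"
  using laplace_phi phi_pos by simp

end
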